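(* Let $R$ be a finite ring with $|\mathrm{Cent}(R)| = 7$. Then $|R : Z(R)| \in \{12, 18, 20, 24, 25\}$.
   Context: Rings are associative; no identity element is assumed. For $x \in R$, $C_R(x) = \{y \in R : xy = yx\}$, and $\mathrm{Cent}(R) = \{C_R(x) : x \in R\}$ is the set of all distinct centralizers of elements of $R$. A ring is called $n$-centralizer if $|\mathrm{Cent}(R)| = n$. $Z(R) = \{s \in R : rs = sr \text{ for all } r \in R\}$ is the center of $R$, and $|R : Z(R)|$ is the index of the additive subgroup $Z(R)$ in the additive group of $R$. *)

theory Defs
  imports Main
begin

(* The type class "ring" of Main is associative and does not assume an identity element. *)

definition centralizer :: "'a::ring \<Rightarrow> 'a set"
  where "centralizer x = {y. x * y = y * x}"

definition Cent :: "'a::ring set set"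
  where "Cent = range centralizer"

definition ring_center :: "'a::ring set"
  where "ring_center = {s. \<forall>r. r * s = s * r}"

(* The index of an additive subgroup S, as the number of cosets x + S. *)
definition additive_index :: "'a::ab_group_add set \<Rightarrow> nat"
  where "additive_index S = card (range (\<lambda>x. (\<lambda>s. x + s) ` S))"

end

theory Submission
  imports Defs
begin

text \<open>
  Write $Z$ for the center and $D(x)$ for the set of all $y$ with $C(x) \subseteq C(y)$, which is the
  center of the ring $C(x)$. Since $D(x)$ and $C(x)$ determine each other, a ring with seven
  centralizers has exactly six sets $D(x)$ with $x \notin Z$. These are commutative proper
  subgroups that contain $Z$ and cover $R$, and $y \in D(x)$ forces $D(y) \subseteq D(x)$, so an
  intersection of two of them is $Z$ together with a union of smaller ones.

  The main point (\<open>noncentral_bicentralizers_antichain\<close>) is that no one of the six contains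
  another. A proper inclusion $D(x) \subset D(a)$ would make $H = C(x)$ a large proper subgroup which
  is a union of sets $D(y)$. A group is never a union of two proper subgroups, so $H$ needs three
  maximal $D(y)$ to be covered, $D(x)$ is not one of them, and at least two more are needed to cover
  $R$ outside $H$. That uses up all six: $H$ is covered by three subgroups, and $R$ by $H$ and two
  others. In a cover by three proper subgroups all pairwise intersections coincide and have index 2
  in each of the three. Playing the two covers against each other puts $x$ into both of the sets
  that cover $R$ outside $H$. Then $x$ commutes with everything, which it does not.

  Hence the six sets pairwise meet in $Z$, and $R/Z$, of order $n$, is partitioned (apart from $0$)
  by six nontrivial subgroups of orders $d_i$. So $n - 1 = \sum_i (d_i - 1)$, and $d_i d_j$ divides $n$
  for $i \neq j$ because the subgroups meet trivially. These conditions force $n = 25$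
  (\<open>six_part_partition_order\<close>), so the only index that occurs is that of a ring with $R/Z$ of
  order $5^2$ split into its six subgroups of order 5.
\<close>

section \<open>Covering an additive group by subgroups\<close>

definition add_subgroup :: "'a::ab_group_add set \<Rightarrow> bool"
  where "add_subgroup S \<longleftrightarrow> 0 \<in> S \<and> (\<forall>x\<in>S. \<forall>y\<in>S. x - y \<in> S)"

lemma add_subgroupI:
  assumes "0 \<in> S" "\<And>x y. x \<in> S \<Longrightarrow> y \<in> S \<Longrightarrow> x - y \<in> S"
  shows "add_subgroup S"
  using assms by (auto simp: add_subgroup_def)

lemma add_subgroup_zero: "add_subgroup S \<Longrightarrow> 0 \<in> S"
  by (simp add: add_subgroup_def)

lemma add_subgroup_diff: "add_subgroup S \<Longrightarrow> x \<in> S \<Longrightarrow> y \<in> S \<Longrightarrow> x - y \<in> S"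
  by (simp add: add_subgroup_def)

lemma add_subgroup_add:
  assumes "add_subgroup S" "x \<in> S" "y \<in> S"
  shows "x + y \<in> S"
  using add_subgroup_diff[OF assms(1,2) add_subgroup_diff[OF assms(1) add_subgroup_zero assms(3)]]
    assms(1) by simp

lemma add_subgroup_add_cancel_left:
  "add_subgroup S \<Longrightarrow> x \<in> S \<Longrightarrow> x + y \<in> S \<longleftrightarrow> y \<in> S"
  using add_subgroup_add add_subgroup_diff by (metis add_diff_cancel_left')

lemma add_subgroup_add_cancel_right:
  "add_subgroup S \<Longrightarrow> y \<in> S \<Longrightarrow> x + y \<in> S \<longleftrightarrow> x \<in> S"
  using add_subgroup_add_cancel_left by (metis add.commute)

lemma add_subgroup_not_Un:
  assumes T: "add_subgroup T" and S: "add_subgroup S" and S': "add_subgroup S'"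
    and "S \<subset> T" "S' \<subset> T"
  shows "T \<noteq> S \<union> S'"
proof
  assume cover: "T = S \<union> S'"
  obtain a where a: "a \<in> T" "a \<notin> S" using assms by blast
  obtain b where b: "b \<in> T" "b \<notin> S'" using assms by blast
  have "a \<in> S'" "b \<in> S" using a b cover by auto
  moreover have "a + b \<in> S \<union> S'" using add_subgroup_add[OF T a(1) b(1)] cover by simp
  ultimately show False
    using a b add_subgroup_add_cancel_left[OF S'] add_subgroup_add_cancel_right[OF S] by blast
qed

lemma card_cover_ge_3:
  assumes T: "add_subgroup T" and cover: "T = \<Union>\<F>"
    and proper: "\<And>S. S \<in> \<F> \<Longrightarrow> add_subgroup S \<and> S \<subset> T" and fin: "finite \<F>"
  shows "card \<F> \<ge> 3"
proof (rule ccontr)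
  assume "\<not> card \<F> \<ge> 3"
  then consider "card \<F> = 0" | "card \<F> = 1" | "card \<F> = 2" by linarith
  then show False
  proof cases
    case 1
    then show False using fin cover add_subgroup_zero[OF T] by simp
  next
    case 2
    then obtain S where "\<F> = {S}" by (auto simp: card_1_singleton_iff)
    then show False using cover proper by auto
  next
    case 3
    then obtain S S' where "\<F> = {S, S'}" by (auto simp: card_2_iff)
    then show False using cover proper add_subgroup_not_Un[OF T] by auto
  qed
qed

text \<open>
  A translation argument: if $c$ lies in $C$ only and $x \in A \cap B$, then $x + c$ avoids $A$ and
  $B$, hence lies in $C$, and so does $x$. By symmetry the three pairwise intersections coincide.
\<close>

lemma three_cover_inter_subset:
  assumes T: "add_subgroup T" and cover: "T = A \<union> B \<union> C"
    and sub: "add_subgroup A" "add_subgroup B" "add_subgroup C"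
    and proper: "A \<subset> T" "B \<subset> T" "C \<subset> T"
  shows "A \<inter> B \<subseteq> C"
proof
  fix x assume x: "x \<in> A \<inter> B"
  obtain c where c: "c \<in> C" "c \<notin> A" "c \<notin> B"
    using add_subgroup_not_Un[OF T sub(1,2) proper(1,2)] cover by blast
  have "x + c \<in> T" using add_subgroup_add[OF T, of x c] x c cover by blast
  moreover have "x + c \<notin> A" "x + c \<notin> B"
    using x c add_subgroup_add_cancel_left[OF sub(1)] add_subgroup_add_cancel_left[OF sub(2)] by auto
  ultimately show "x \<in> C"
    using cover c add_subgroup_add_cancel_right[OF sub(3)] by auto
qed

text \<open>
  Adding a fixed $b$ that lies in $B$ only carries every element of $A$ outside $B$ into $C$, so two
  such elements differ by an element of $A \cap C = A \cap B \cap C$.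
\<close>

lemma three_cover_diff_mem:
  assumes T: "add_subgroup T" and cover: "T = A \<union> B \<union> C"
    and sub: "add_subgroup A" "add_subgroup B" "add_subgroup C"
    and proper: "A \<subset> T" "B \<subset> T" "C \<subset> T"
    and x: "x \<in> A" "x \<notin> B" and y: "y \<in> A" "y \<notin> B"
  shows "x - y \<in> B"
proof -
  have "A \<inter> C \<subseteq> B" and BC: "B \<inter> C \<subseteq> A"
    using three_cover_inter_subset[OF T _ sub(1,3,2) proper(1,3,2)]
      three_cover_inter_subset[OF T _ sub(2,3,1) proper(2,3,1)] cover by auto
  moreover obtain b where b: "b \<in> B" "b \<notin> A"
    using add_subgroup_not_Un[OF T sub(1,3) proper(1,3)] cover BC by blast
  have "z + b \<in> C" if "z \<in> A" "z \<notin> B" for z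
  proof -
    have "z + b \<in> T" using add_subgroup_add[OF T, of z b] that b cover by blast
    moreover have "z + b \<notin> A" "z + b \<notin> B"
      using that b add_subgroup_add_cancel_left[OF sub(1)]
        add_subgroup_add_cancel_right[OF sub(2)] by auto
    ultimately show ?thesis using cover by auto
  qed
  then have "(x + b) - (y + b) \<in> C" using x y sub(3) add_subgroup_diff by blast
  then have "x - y \<in> A \<inter> C" using x y add_subgroup_diff[OF sub(1)] by simp
  ultimately show ?thesis by blast
qed

text \<open>
  In other words, the common intersection has index 2 in each of the three subgroups.
\<close>

lemma three_cover_outside_diff_mem:
  assumes T: "add_subgroup T" and cover: "T = A \<union> B \<union> C"
    and sub: "add_subgroup A" "add_subgroup B" "add_subgroup C"
    and proper: "A \<subset> T" "B \<subset> T" "C \<subset> T"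
    and x: "x \<in> A" "x \<notin> B" and y: "y \<in> A" "y \<notin> B"
  shows "x - y \<in> A \<inter> B \<inter> C"
  using three_cover_diff_mem[OF assms] three_cover_inter_subset[OF assms(1-8)]
    add_subgroup_diff[OF sub(1) x(1) y(1)] by blast

section \<open>Counting in finite additive groups\<close>

lemma card_eq_card_image_times_fibre:
  assumes "finite X" "\<And>x. x \<in> X \<Longrightarrow> card {x' \<in> X. f x' = f x} = m"
  shows "card X = card (f ` X) * m"
proof -
  have "card X = (\<Sum>y\<in>f ` X. \<Sum>x\<in>{x \<in> X. f x = y}. 1)"
    using sum.image_gen[OF assms(1), of "\<lambda>_. 1 :: nat" f] by (simp only: card_eq_sum)
  also have "\<dots> = (\<Sum>y\<in>f ` X. m)"
    using assms(2) by (intro sum.cong) (auto simp flip: card_eq_sum)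
  finally show ?thesis by simp
qed

lemma card_cosets:
  assumes S: "add_subgroup (S :: 'a::ab_group_add set)" and T: "add_subgroup T" "S \<subseteq> T" "finite T"
  shows "card T = card ((\<lambda>x. (\<lambda>s. x + s) ` S) ` T) * card S"
proof (rule card_eq_card_image_times_fibre[OF T(3)])
  fix x assume x: "x \<in> T"
  have "{x' \<in> T. (+) x' ` S = (+) x ` S} = (+) x ` S"
  proof (intro equalityI subsetI)
    fix y assume "y \<in> {x' \<in> T. (+) x' ` S = (+) x ` S}"
    then show "y \<in> (+) x ` S" using add_subgroup_zero[OF S] by force
  next
    fix y assume "y \<in> (+) x ` S"
    then obtain s where s: "s \<in> S" "y = x + s" by auto
    have "(+) (x + s) ` S = (+) x ` S"
    proof (intro equalityI subsetI)
      fix z assume "z \<in> (+) (x + s) ` S"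
      then show "z \<in> (+) x ` S" using add_subgroup_add[OF S s(1)] by (auto simp: add.assoc)
    next
      fix z assume "z \<in> (+) x ` S"
      then obtain t where t: "t \<in> S" "z = x + t" by auto
      then have "z = (x + s) + (t - s)" by simp
      then show "z \<in> (+) (x + s) ` S" using add_subgroup_diff[OF S t(1) s(1)] by blast
    qed
    then show "y \<in> {x' \<in> T. (+) x' ` S = (+) x ` S}"
      using s x T add_subgroup_add[OF T(1)] by auto
  qed
  then show "card {x' \<in> T. (+) x' ` S = (+) x ` S} = card S"
    by (simp add: card_image)
qed

corollary card_add_subgroup_dvd:
  assumes "add_subgroup S" "add_subgroup T" "S \<subseteq> T" "finite T"
  shows "card S dvd card T"
  using card_cosets[OF assms] by simp

text \<open>
  The map $(s, t) \mapsto s + t$ on $S \times T$ has all its fibres of size $|S \cap T|$, and its image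
  $S + T$ is a subgroup, whose order divides that of the whole group.
\<close>

lemma card_times_card_inter_dvd:
  fixes S T :: "'a::{ab_group_add,finite} set"
  assumes S: "add_subgroup S" and T: "add_subgroup T"
  shows "card S * card T dvd card (UNIV :: 'a set) * card (S \<inter> T)"
proof -
  let ?f = "\<lambda>(s, t). s + t"
  have "card (S \<times> T) = card (?f ` (S \<times> T)) * card (S \<inter> T)"
  proof (rule card_eq_card_image_times_fibre)
    fix p assume "p \<in> S \<times> T"
    then obtain s t where p: "p = (s, t)" "s \<in> S" "t \<in> T" by auto
    have "{q \<in> S \<times> T. ?f q = ?f p} = (\<lambda>u. (s + u, t - u)) ` (S \<inter> T)"
    proof (intro equalityI subsetI)
      fix q assume "q \<in> {q \<in> S \<times> T. ?f q = ?f p}"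
      then obtain s' t' where q: "q = (s', t')" "s' \<in> S" "t' \<in> T" "s' + t' = s + t"
        using p by auto
      have "s' - s = t - t'" using q(4) by (simp add: algebra_simps)
      then have "s' - s \<in> S \<inter> T"
        using p q add_subgroup_diff[OF S, of s' s] add_subgroup_diff[OF T, of t t'] by simp
      moreover have "q = (s + (s' - s), t - (s' - s))"
        using q(1) \<open>s' - s = t - t'\<close> by (simp add: algebra_simps)
      ultimately
      show "q \<in> (\<lambda>u. (s + u, t - u)) ` (S \<inter> T)" by blast
    qed (use p add_subgroup_add[OF S] add_subgroup_diff[OF T] in auto)
    moreover have "inj_on (\<lambda>u. (s + u, t - u)) (S \<inter> T)" by (auto intro: inj_onI)
    ultimately show "card {q \<in> S \<times> T. ?f q = ?f p} = card (S \<inter> T)"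
      by (simp add: card_image)
  qed simp
  moreover have "add_subgroup (?f ` (S \<times> T))"
  proof (rule add_subgroupI)
    show "0 \<in> ?f ` (S \<times> T)"
      using add_subgroup_zero[OF S] add_subgroup_zero[OF T] by force
    fix x y assume "x \<in> ?f ` (S \<times> T)" "y \<in> ?f ` (S \<times> T)"
    then obtain a b c d where "x = a + b" "y = c + d" "a \<in> S" "c \<in> S" "b \<in> T" "d \<in> T" by auto
    then have "x - y = ?f (a - c, b - d)" "(a - c, b - d) \<in> S \<times> T"
      using add_subgroup_diff[OF S] add_subgroup_diff[OF T] by auto
    then show "x - y \<in> ?f ` (S \<times> T)" by blast
  qed
  then have "card (?f ` (S \<times> T)) dvd card (UNIV :: 'a set)"
    by (rule card_add_subgroup_dvd) (simp_all add: add_subgroup_def)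
  ultimately show ?thesis by (simp add: card_cartesian_product mult_dvd_mono)
qed

text \<open>
  The numbers $d_i$ stand for the orders of six nontrivial subgroups that partition a group of order
  $n$. Let $m$ be the largest $d_i$ and $n = m e$. The other $d_i$ divide $e$, and the sum of their
  five terms $d_i - 1$ is $m (e - 1)$. As each term is at most $e - 1$, this gives $m \le 5$. Equality
  makes the others all equal to $e$, so $e^2$ divides $5 e$ and $e = 5$. If $m \le 4$, then
  $d_i \le m$ gives $e \le 4$. When $e$ is 2 or 3 the divisors of $e$ again leave only $d_i = e$,
  which means $m = 5$. When $e = 4$ each $d_i - 1$ is odd, so $m$ is odd, that is, $m = 3$; then all
  $d_i$ are 2, and the sum is 5 instead of 9.
\<close>

lemma six_part_partition_order:
  fixes d :: "'i \<Rightarrow> nat" and n :: nat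
  assumes F: "card F = 6" and n: "n = 1 + (\<Sum>i\<in>F. d i - 1)"
    and d2: "\<And>i. i \<in> F \<Longrightarrow> d i \<ge> 2"
    and pairs: "\<And>i j. i \<in> F \<Longrightarrow> j \<in> F \<Longrightarrow> i \<noteq> j \<Longrightarrow> d i * d j dvd n"
  shows "n = 25"
proof -
  have fin: "finite F" and "F \<noteq> {}" using F card.infinite by fastforce+
  then have "Max (d ` F) \<in> d ` F" by simp
  then obtain k where k: "k \<in> F" and "d k = Max (d ` F)" by auto
  then have max: "d i \<le> d k" if "i \<in> F" for i using fin that by simp
  define m where "m = d k"
  define G where "G = F - {k}"
  have G: "finite G" "card G = 5" using F k fin by (auto simp: G_def)
  have m2: "m \<ge> 2" using d2[OF k] by (simp add: m_def)
  obtain a b where ab: "a \<in> G" "b \<in> G" "a \<noteq> b"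
    using card_le_Suc0_iff_eq[OF G(1)] G(2) by auto
  have "m dvd n" using pairs[of k a] ab k by (auto simp: G_def m_def intro: dvd_mult_left)
  then obtain e where e: "n = m * e" by (elim dvdE)
  have "n > 0" using n by simp
  then have e0: "e > 0" using e by (cases e) auto
  have dvd_e: "d i dvd e" if "i \<in> G" for i
    using pairs[of k i] that k m2 by (auto simp: G_def m_def e)
  have le_e: "d i \<le> e" if "i \<in> G" for i using dvd_e[OF that] e0 by (rule dvd_imp_le)
  have le_m: "d i \<le> m" and ge2: "d i \<ge> 2" if "i \<in> G" for i
    using that max d2 by (auto simp: G_def m_def)
  have e2: "e \<ge> 2" using le_e ge2 ab by fastforce
  have "n = 1 + (m - 1) + (\<Sum>i\<in>G. d i - 1)"
    using n sum.remove[OF fin k, of "\<lambda>i. d i - 1"] by (simp add: G_def m_def)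
  then have sum: "(\<Sum>i\<in>G. d i - 1) = m * (e - 1)"
    using e m2 by (simp add: diff_mult_distrib2)
  have const: "(\<Sum>i\<in>G. d i - 1) = 5 * (c - 1)" if "\<And>i. i \<in> G \<Longrightarrow> d i = c" for c
    using that G by simp
  have "(\<Sum>i\<in>G. d i - 1) \<le> card G * (e - 1)"
    using sum_bounded_above[of G "\<lambda>i. d i - 1" "e - 1"] le_e by (auto intro: diff_le_mono)
  then have m5: "m \<le> 5" using sum G e2 by simp
  have bound: "m * (e - 1) \<le> 5 * (m - 1)"
    using sum_bounded_above[of G "\<lambda>i. d i - 1" "m - 1"] le_m sum G by (auto intro: diff_le_mono)
  have "m = 5"
  proof (rule ccontr)
    assume "m \<noteq> 5"
    then consider "m = 2" | "m = 3" | "m = 4" using m2 m5 by linarith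
    then have "e \<le> 4" using bound by cases auto
    then consider "e = 2" | "e = 3" | "e = 4" using e2 by linarith
    then show False
    proof cases
      case 1
      then have "d i = 2" if "i \<in> G" for i using le_e[OF that] ge2[OF that] by simp
      then show False using const[of 2] sum 1 \<open>m \<noteq> 5\<close> by simp
    next
      case 2
      have "d i = 3" if "i \<in> G" for i
        using dvd_e[OF that] le_e[OF that] ge2[OF that] 2 by (cases "d i = 2") auto
      then show False using const[of 3] sum 2 \<open>m \<noteq> 5\<close> by simp
    next
      case 3
      have d24: "d i = 2 \<or> d i = 4" if "i \<in> G" for i
        using dvd_e[OF that] le_e[OF that] ge2[OF that] 3 by (cases "d i = 3") auto
      have odd: "odd (d i - 1)" if "i \<in> G" for i using d24[OF that] by auto
      have "odd (\<Sum>i\<in>G. d i - 1)"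
      proof -
        have "{i \<in> G. odd (d i - 1)} = G" using odd by blast
        then show ?thesis using even_sum_iff[OF G(1), of "\<lambda>i. d i - 1"] G(2) by simp
      qed
      then have "odd m" using sum by simp
      moreover have "m \<noteq> 2" using bound 3 by auto
      ultimately have "m = 3" using m2 m5 \<open>m \<noteq> 5\<close> by presburger
      then have "d i = 2" if "i \<in> G" for i using d24[OF that] le_m[OF that] by auto
      then show False using const[of 2] sum 3 \<open>m = 3\<close> by simp
    qed
  qed
  have eq_e: "d i = e" if "i \<in> G" for i
  proof (rule ccontr)
    assume "d i \<noteq> e"
    then have "d i - 1 < e - 1" using le_e[OF that] ge2[OF that] by simp
    then have "(\<Sum>i\<in>G. d i - 1) < (\<Sum>i\<in>G. e - 1)"
      using that G(1) le_e by (intro sum_strict_mono_ex1) (auto intro: diff_le_mono)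
    then show False using sum \<open>m = 5\<close> G by simp
  qed
  have "e * e dvd 5 * e"
    using pairs[of a b] ab eq_e e \<open>m = 5\<close> by (auto simp: G_def)
  then have "e dvd 5" using e0 by simp
  moreover have "e \<le> 5" using \<open>e dvd 5\<close> by (rule dvd_imp_le) simp
  moreover have "\<not> (2::nat) dvd 5" "\<not> (3::nat) dvd 5" "\<not> (4::nat) dvd 5" by presburger+
  ultimately have "e = 5"
  proof -
    have "e = 2 \<or> e = 3 \<or> e = 4 \<or> e = 5" using e2 \<open>e \<le> 5\<close> by linarith
    then show ?thesis
      using \<open>e dvd 5\<close> \<open>\<not> (2::nat) dvd 5\<close> \<open>\<not> (3::nat) dvd 5\<close> \<open>\<not> (4::nat) dvd 5\<close> by blast
  qed
  then show ?thesis using e \<open>m = 5\<close> by simp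
qed

section \<open>Centers of centralizers\<close>

definition bicentralizer :: "'a::ring \<Rightarrow> 'a set"
  where "bicentralizer x = {y. centralizer x \<subseteq> centralizer y}"

lemma mem_centralizer_commute: "y \<in> centralizer x \<longleftrightarrow> x \<in> centralizer y"
  by (auto simp: centralizer_def)

lemma self_mem_centralizer: "x \<in> centralizer x"
  by (simp add: centralizer_def)

lemma self_mem_bicentralizer: "x \<in> bicentralizer x"
  by (simp add: bicentralizer_def)

lemma add_subgroup_centralizer: "add_subgroup (centralizer x)"
  by (rule add_subgroupI) (auto simp: centralizer_def algebra_simps)

lemma add_subgroup_bicentralizer: "add_subgroup (bicentralizer x)"
  by (rule add_subgroupI) (auto simp: bicentralizer_def centralizer_def algebra_simps subset_iff)

lemma add_subgroup_ring_center: "add_subgroup ring_center"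
  by (rule add_subgroupI) (auto simp: ring_center_def algebra_simps)

lemma ring_center_iff: "x \<in> ring_center \<longleftrightarrow> centralizer x = UNIV"
  by (auto simp: ring_center_def centralizer_def set_eq_iff)

lemma bicentralizer_subset_iff: "bicentralizer y \<subseteq> bicentralizer x \<longleftrightarrow> y \<in> bicentralizer x"
  by (auto simp: bicentralizer_def)

lemma bicentralizer_eq_iff: "bicentralizer x = bicentralizer y \<longleftrightarrow> centralizer x = centralizer y"
  by (auto simp: bicentralizer_def)

lemma bicentralizer_subset_centralizer:
  "x \<in> centralizer y \<Longrightarrow> bicentralizer x \<subseteq> centralizer y"
  unfolding bicentralizer_def using mem_centralizer_commute by blast

text \<open>
  This set lies in $C(x)$, and each of its elements commutes with all of $C(x)$.
\<close>

lemma bicentralizer_commute: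
  assumes "y \<in> bicentralizer x" "z \<in> bicentralizer x"
  shows "z \<in> centralizer y"
  using assms bicentralizer_subset_centralizer[OF self_mem_centralizer, of x]
  by (auto simp: bicentralizer_def)

lemma ring_center_subset_bicentralizer: "ring_center \<subseteq> bicentralizer x"
  by (auto simp: bicentralizer_def ring_center_iff)

lemma bicentralizer_eq_ring_center_iff: "bicentralizer x = ring_center \<longleftrightarrow> x \<in> ring_center"
proof
  show "bicentralizer x = ring_center" if "x \<in> ring_center"
    using that unfolding ring_center_iff by (auto simp: bicentralizer_def ring_center_iff)
qed (use self_mem_bicentralizer in blast)

definition noncentral_bicentralizers :: "'a::ring set set"
  where "noncentral_bicentralizers = bicentralizer ` (- ring_center)"

text \<open>
  The set $D(x)$ depends only on $C(x)$ and determines it, and central elements are those with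
  $D(x) = Z$; so exactly one centralizer, the whole ring, is lost.
\<close>

lemma card_noncentral_bicentralizers:
  "card (noncentral_bicentralizers :: 'a::{ring,finite} set set) = card (Cent :: 'a set set) - 1"
proof -
  let ?g = "\<lambda>C. {y :: 'a. C \<subseteq> centralizer y}"
  have "inj_on ?g (Cent :: 'a set set)"
  proof (rule inj_onI)
    fix C C' :: "'a set" assume "C \<in> Cent" "C' \<in> Cent" "?g C = ?g C'"
    then show "C = C'"
      unfolding Cent_def using bicentralizer_eq_iff unfolding bicentralizer_def by fast
  qed
  moreover have "?g ` Cent = range bicentralizer"
    by (simp add: Cent_def bicentralizer_def[abs_def] image_image)
  ultimately have "card (Cent :: 'a set set) = card (range (bicentralizer :: 'a \<Rightarrow> _))"
    using card_image by metis
  moreover have "noncentral_bicentralizers = range (bicentralizer :: 'a \<Rightarrow> _) - {ring_center}"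
    using bicentralizer_eq_ring_center_iff unfolding noncentral_bicentralizers_def by blast
  moreover have "(0::'a) \<in> ring_center" by (simp add: ring_center_def)
  then have "(ring_center :: 'a set) \<in> range bicentralizer"
    using bicentralizer_eq_ring_center_iff by blast
  ultimately show ?thesis by (metis card_Diff_singleton)
qed

lemma bicentralizer_mem:
  "x \<notin> ring_center \<Longrightarrow> bicentralizer x \<in> noncentral_bicentralizers"
  by (simp add: noncentral_bicentralizers_def)

lemma noncentral_bicentralizer_proper:
  fixes D :: "'a::ring set"
  assumes "D \<in> noncentral_bicentralizers"
  shows "D \<noteq> UNIV"
proof
  assume "D = UNIV"
  with assms obtain x :: 'a where x: "x \<notin> ring_center" "bicentralizer x = UNIV"
    by (auto simp: noncentral_bicentralizers_def)
  then have "y \<in> centralizer x" for y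
    using bicentralizer_commute[of x x y] by simp
  then show False using x ring_center_iff by blast
qed

section \<open>Rings with six proper centralizers\<close>

text \<open>
  A proper inclusion $N \subset M$ with $N = D(x)$ and $M = D(a)$ is refuted by counting inside and
  outside $H = C(x)$. The inclusion makes $H$ strictly larger than $C(a)$, so $H$ is not one of the
  sets $D(y)$: such a set is commutative and, containing $a$, would lie in $C(a)$. Thus $H$ is covered by at
  least three maximal ones among those it contains, and the six are used up as three maximal ones in
  $H$, the set $N$, and two that are not contained in $H$.
\<close>

lemma noncentral_bicentralizers_antichain:
  assumes card6: "card (noncentral_bicentralizers :: 'a::{ring,finite} set set) = 6"
    and N: "N \<in> (noncentral_bicentralizers :: 'a set set)" and M: "M \<in> noncentral_bicentralizers"
    and "N \<subseteq> M"
  shows "N = M"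
proof (rule ccontr)
  assume "N \<noteq> M"
  let ?D = "noncentral_bicentralizers :: 'a set set"
  have subgroup: "add_subgroup D" if "D \<in> ?D" for D
    using that add_subgroup_bicentralizer by (auto simp: noncentral_bicentralizers_def)
  have below: "bicentralizer y \<subseteq> D" if "D \<in> ?D" "y \<in> D" for y D
    using that bicentralizer_subset_iff by (auto simp: noncentral_bicentralizers_def)
  have UNIV: "add_subgroup (UNIV :: 'a set)" by (simp add: add_subgroup_def)
  obtain x where x: "x \<notin> ring_center" "N = bicentralizer x"
    using N by (auto simp: noncentral_bicentralizers_def)
  obtain a where a: "M = bicentralizer a" using M by (auto simp: noncentral_bicentralizers_def)
  have less: "centralizer a \<subset> centralizer x"
    using \<open>N \<subseteq> M\<close> \<open>N \<noteq> M\<close> x a bicentralizer_eq_iff[of x a] bicentralizer_subset_iff[of x a]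
    by (auto simp: bicentralizer_def)
  define H where "H = centralizer x"
  have H: "add_subgroup H" by (simp add: H_def add_subgroup_centralizer)
  have H_proper: "H \<subset> UNIV" using x ring_center_iff by (auto simp: H_def)
  have MH: "M \<subseteq> H"
    using bicentralizer_subset_centralizer[of a x] less self_mem_centralizer[of a]
    by (auto simp: a H_def)
  have below_H: "bicentralizer y \<subseteq> H" if "y \<in> H" for y
    using that bicentralizer_subset_centralizer by (simp add: H_def)
  have not_H: "D \<noteq> H" if "D \<in> ?D" for D
  proof
    assume "D = H"
    with that obtain y where y: "bicentralizer y = centralizer x"
      by (auto simp: noncentral_bicentralizers_def H_def)
    then have "a \<in> bicentralizer y" using less self_mem_centralizer by blast
    then have "centralizer y \<subseteq> centralizer a" by (simp add: bicentralizer_def)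
    moreover have "bicentralizer y \<subseteq> centralizer y"
      by (rule bicentralizer_subset_centralizer[OF self_mem_centralizer])
    ultimately show False using y less by blast
  qed
  define P where "P = {D \<in> ?D. D \<subseteq> H \<and> (\<forall>E\<in>?D. E \<subseteq> H \<longrightarrow> D \<subseteq> E \<longrightarrow> D = E)}"
  define Q where "Q = {D \<in> ?D. \<not> D \<subseteq> H}"
  have P_max: "\<exists>E\<in>P. D \<subseteq> E" if "D \<in> ?D" "D \<subseteq> H" for D
  proof -
    have "finite {E \<in> ?D. E \<subseteq> H}" by simp
    from finite_has_maximal2[OF this, of D] that obtain E where
      "E \<in> {E \<in> ?D. E \<subseteq> H}" "D \<subseteq> E" "\<forall>F\<in>{E \<in> ?D. E \<subseteq> H}. E \<subseteq> F \<longrightarrow> E = F"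
      by blast
    then show ?thesis unfolding P_def by blast
  qed
  have coverH: "H = \<Union>P"
  proof (intro equalityI subsetI)
    fix y assume y: "y \<in> H"
    show "y \<in> \<Union>P"
    proof (cases "y \<in> ring_center")
      case True
      then have "y \<in> M" using ring_center_subset_bicentralizer a by blast
      then show ?thesis using P_max[OF M MH] by blast
    next
      case False
      then show ?thesis
        using P_max[OF bicentralizer_mem below_H[OF y]] self_mem_bicentralizer[of y] by blast
    qed
  qed (auto simp: P_def)
  have P_proper: "add_subgroup S \<and> S \<subset> H" if "S \<in> P" for S
    using that subgroup not_H by (auto simp: P_def)
  have cardP: "card P \<ge> 3"
    by (rule card_cover_ge_3[OF H coverH P_proper]) simp_all
  have coverR: "UNIV = \<Union>(insert H Q)"
  proof -
    have "y \<in> \<Union>(insert H Q)" for y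
      using bicentralizer_mem[of y] self_mem_bicentralizer[of y] ring_center_iff[of y]
        mem_centralizer_commute[of y x]
      by (cases "y \<in> ring_center") (auto simp: Q_def H_def)
    then show ?thesis by blast
  qed
  have Q_proper: "add_subgroup S \<and> S \<subset> UNIV" if "S \<in> insert H Q" for S
    using that subgroup noncentral_bicentralizer_proper H H_proper by (auto simp: Q_def)
  have "card (insert H Q) \<ge> 3"
    by (rule card_cover_ge_3[OF UNIV coverR Q_proper]) simp_all
  moreover have "card (insert H Q) = Suc (card Q)" by (simp add: Q_def)
  ultimately have cardQ: "card Q \<ge> 2" by simp
  have "N \<notin> P" using \<open>N \<subseteq> M\<close> \<open>N \<noteq> M\<close> M MH by (auto simp: P_def)
  have disj: "insert N P \<inter> Q = {}"
    using \<open>N \<subseteq> M\<close> MH by (auto simp: P_def Q_def)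
  have "card (insert N P \<union> Q) = Suc (card P) + card Q"
    using card_Un_disjoint[OF _ _ disj] \<open>N \<notin> P\<close> by simp
  moreover have sub: "insert N P \<union> Q \<subseteq> ?D" using N by (auto simp: P_def Q_def)
  then have "card (insert N P \<union> Q) \<le> 6" using card_mono[OF _ sub] card6 by simp
  ultimately have cardP: "card P = 3" and cardQ: "card Q = 2" and "card (insert N P \<union> Q) = card ?D"
    using cardP cardQ card6 by linarith+
  then have D: "?D = insert N P \<union> Q" using card_subset_eq[OF _ sub] by simp
  obtain P1 where P1: "P1 \<in> P" "M \<subseteq> P1" using P_max[OF M MH] by blast
  have "card (P - {P1}) = 2" using cardP P1 by simp
  then obtain P2 P3 where "P - {P1} = {P2, P3}" "P2 \<noteq> P3" by (auto simp: card_2_iff)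
  then have P: "P = {P1, P2, P3}" "P1 \<noteq> P2" "P1 \<noteq> P3" "P2 \<noteq> P3" using P1 by auto
  obtain Q1 Q2 where Q: "Q = {Q1, Q2}" using cardQ by (auto simp: card_2_iff)
  have P_anti: "A = B" if "A \<in> P" "B \<in> P" "A \<subseteq> B" for A B
    using that unfolding P_def by blast
  have Psub: "add_subgroup P1" "add_subgroup P2" "add_subgroup P3"
    "P1 \<subset> H" "P2 \<subset> H" "P3 \<subset> H" using P_proper P by auto
  have HP: "H = P1 \<union> P2 \<union> P3" using coverH P by auto
  have Qsub: "add_subgroup Q1" "add_subgroup Q2" "Q1 \<subset> UNIV" "Q2 \<subset> UNIV"
    using Q_proper Q by auto
  have RQ: "UNIV = H \<union> Q1 \<union> Q2" using coverR Q by auto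
  have NP1: "N \<subset> P1" using \<open>N \<subseteq> M\<close> \<open>N \<noteq> M\<close> P1 by blast
  have P_or_N: "bicentralizer y \<in> insert N P" if "y \<in> H" "y \<notin> ring_center" for y
    using bicentralizer_mem[OF that(2)] below_H[OF that(1)] D by (auto simp: Q_def)
  \<comment> \<open>Two maximal sets in $H$ meet, apart from $Z$, in elements $y$ whose $D(y)$ is not maximal, so $D(y) = N$.\<close>
  have inter_N: "y \<in> N" if "y \<in> A" "y \<in> B" "A \<in> P" "B \<in> P" "A \<noteq> B" for y A B
  proof (cases "y \<in> ring_center")
    case True
    then show ?thesis using x ring_center_subset_bicentralizer by blast
  next
    case False
    have AB: "A \<in> ?D" "B \<in> ?D" "A \<subseteq> H" using that by (auto simp: P_def)
    have "bicentralizer y \<notin> P"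
      using P_anti[of "bicentralizer y"] below[OF AB(1)] below[OF AB(2)] that by metis
    then have "bicentralizer y = N" using P_or_N[OF _ False] that AB by auto
    then show ?thesis using self_mem_bicentralizer by blast
  qed
  \<comment> \<open>$N$ lies between $P_1 \cap P_2$ and $P_1$, and the former has index 2 in $P_1 \supset N$, so $N = P_1 \cap P_2$.\<close>
  have N_sub: "N \<subseteq> P2"
  proof (rule ccontr)
    assume "\<not> N \<subseteq> P2"
    then obtain u where u: "u \<in> N" "u \<notin> P2" by blast
    obtain v where v: "v \<in> P1" "v \<notin> N" using NP1 by blast
    have "v \<notin> P2" using inter_N[of v P1 P2] v P by auto
    then have "v - u \<in> P1 \<inter> P2 \<inter> P3"
      using three_cover_outside_diff_mem[OF H HP Psub, of v u] u v NP1 by auto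
    then have "v - u \<in> N" using inter_N[of "v - u" P1 P2] P by auto
    then have "(v - u) + u \<in> N" using add_subgroup_add[OF subgroup[OF N]] u by blast
    then show False using v by simp
  qed
  have N_all: "N \<subseteq> A" if "A \<in> P" for A
    using that P NP1 N_sub three_cover_inter_subset[OF H HP Psub] by blast
  obtain p1 where p1: "p1 \<in> P1" "p1 \<notin> N" using NP1 by blast
  have "\<not> P2 \<subseteq> P1" using P_anti[of P2 P1] P by auto
  then have "\<not> P2 \<subseteq> N" using NP1 by (meson order.trans psubset_imp_subset)
  then obtain p2 where p2: "p2 \<in> P2" "p2 \<notin> N" by blast
  \<comment> \<open>Otherwise $H \cap Q_1 \subseteq N$. As $H \cap Q_1$ has index 2 in $H$, the elements $p_1$ and $p_2$
    outside it differ by an element of it, hence of $N$, although they lie in different $P_i$.\<close>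
  have "\<exists>A\<in>P. A \<subseteq> Q1"
  proof -
    have outside: "\<exists>A\<in>P. A \<subseteq> Q1" if "q \<in> H" "q \<notin> N" "q \<in> Q1" for q
    proof -
      have "q \<notin> ring_center" using that x ring_center_subset_bicentralizer by blast
      moreover have "bicentralizer q \<noteq> N" using self_mem_bicentralizer[of q] that by blast
      ultimately have "bicentralizer q \<in> P" using P_or_N that by blast
      moreover have "Q1 \<in> ?D" using Q by (auto simp: Q_def)
      ultimately show ?thesis using below that by blast
    qed
    have pH: "p1 \<in> H" "p2 \<in> H" using p1 p2 HP by auto
    show ?thesis
    proof (cases "p1 \<in> Q1 \<or> p2 \<in> Q1")
      case True
      then show ?thesis using outside pH p1 p2 by blast
    next
      case False
      then have "p1 - p2 \<in> H \<inter> Q1 \<inter> Q2"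
        using three_cover_outside_diff_mem[OF UNIV RQ H Qsub(1,2) H_proper Qsub(3,4)] pH by blast
      moreover have "p1 - p2 \<notin> N"
      proof
        assume "p1 - p2 \<in> N"
        then have "(p1 - p2) + p2 \<in> P2"
          using N_sub p2 add_subgroup_add[OF Psub(2)] by blast
        then have "p1 \<in> P2" by simp
        then show False using inter_N[of p1 P1 P2] p1 P by auto
      qed
      ultimately show ?thesis using outside by blast
    qed
  qed
  then have "x \<in> Q1" using N_all self_mem_bicentralizer x by blast
  moreover have "x \<in> H" by (simp add: H_def self_mem_centralizer)
  ultimately have "x \<in> Q2"
    using three_cover_inter_subset[OF UNIV RQ H Qsub(1,2) H_proper Qsub(3,4)] by blast
  \<comment> \<open>$R$ is the union of $C(x)$ and two commutative sets that both contain $x$.\<close>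
  have "y \<in> centralizer x" for y
  proof -
    have "y \<in> centralizer x" if "E \<in> Q" "x \<in> E" "y \<in> E" for E
      using that bicentralizer_commute by (auto simp: Q_def noncentral_bicentralizers_def)
    then show ?thesis using RQ Q \<open>x \<in> Q1\<close> \<open>x \<in> Q2\<close> unfolding H_def by blast
  qed
  then show False using x ring_center_iff by blast
qed

text \<open>
  The six noncentral sets $D(x)$ pairwise meet in $Z$, since a noncentral $y$ in two of them would
  put $D(y)$ inside both, and so make them equal. Dividing the orders by $|Z|$ turns the cover of $R$
  into the numerical partition above without passing to the quotient group.
\<close>

theorem index_center_eq_25:
  assumes "card (Cent :: ('a::{ring,finite}) set set) = 7"
  shows "additive_index (ring_center :: 'a set) = 25"
proof -
  let ?D = "noncentral_bicentralizers :: 'a set set" and ?Z = "ring_center :: 'a set"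
  define z where "z = card ?Z"
  define d where "d = (\<lambda>D :: 'a set. card D div z)"
  have card6: "card ?D = 6" using assms card_noncentral_bicentralizers[where 'a='a] by simp
  have subgroup: "add_subgroup D" and ZD: "?Z \<subseteq> D" if "D \<in> ?D" for D
    using that add_subgroup_bicentralizer ring_center_subset_bicentralizer
    by (auto simp: noncentral_bicentralizers_def)
  have Z_ne: "?Z \<noteq> D" if "D \<in> ?D" for D
    using that self_mem_bicentralizer by (auto simp: noncentral_bicentralizers_def)
  have "0 \<in> ?Z" by (rule add_subgroup_zero[OF add_subgroup_ring_center])
  then have z0: "z > 0" by (auto simp: z_def card_gt_0_iff)
  have card_D: "card D = z * d D" if "D \<in> ?D" for D
    using card_add_subgroup_dvd[OF add_subgroup_ring_center subgroup ZD] that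
    by (simp add: d_def z_def)
  have card_R: "card (UNIV :: 'a set) = additive_index ?Z * z"
    using card_cosets[OF add_subgroup_ring_center, of "UNIV :: 'a set"]
    by (simp add: additive_index_def z_def add_subgroup_def)
  have inter: "D \<inter> E = ?Z" if "D \<in> ?D" "E \<in> ?D" "D \<noteq> E" for D E
  proof -
    have "y \<in> ?Z" if y: "y \<in> D" "y \<in> E" for y
    proof (rule ccontr)
      assume "y \<notin> ?Z"
      have "bicentralizer y \<subseteq> D" "bicentralizer y \<subseteq> E"
        using y \<open>D \<in> ?D\<close> \<open>E \<in> ?D\<close> bicentralizer_subset_iff
        by (auto simp: noncentral_bicentralizers_def)
      then have "bicentralizer y = D" "bicentralizer y = E"
        using noncentral_bicentralizers_antichain[OF card6 bicentralizer_mem[OF \<open>y \<notin> ?Z\<close>]]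
          \<open>D \<in> ?D\<close> \<open>E \<in> ?D\<close> by blast+
      then show False using \<open>D \<noteq> E\<close> by simp
    qed
    then show ?thesis using ZD that by blast
  qed
  show ?thesis
  proof (rule six_part_partition_order[OF card6, of _ d])
    have "UNIV = ?Z \<union> (\<Union>D\<in>?D. D - ?Z)"
      using self_mem_bicentralizer bicentralizer_mem by blast
    then have "card (UNIV :: 'a set) = card (?Z \<union> (\<Union>D\<in>?D. D - ?Z))" by simp
    also have "\<dots> = z + card (\<Union>D\<in>?D. D - ?Z)"
      unfolding z_def by (rule card_Un_disjoint) auto
    also have "card (\<Union>D\<in>?D. D - ?Z) = (\<Sum>D\<in>?D. card (D - ?Z))"
      using inter by (intro card_UN_disjoint) auto
    also have "\<dots> = (\<Sum>D\<in>?D. z * (d D - 1))"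
    proof (rule sum.cong)
      fix D assume "D \<in> ?D"
      then show "card (D - ?Z) = z * (d D - 1)"
        using card_Diff_subset[OF _ ZD] card_D by (simp add: z_def diff_mult_distrib2)
    qed simp
    finally have "additive_index ?Z * z = z + (\<Sum>D\<in>?D. z * (d D - 1))" using card_R by simp
    also have "\<dots> = (1 + (\<Sum>D\<in>?D. d D - 1)) * z"
      by (simp add: sum_distrib_left algebra_simps)
    finally show "additive_index ?Z = 1 + (\<Sum>D\<in>?D. d D - 1)"
      using z0 by (metis mult_cancel2 less_irrefl)
  next
    fix D assume D: "D \<in> ?D"
    have "z < card D"
      unfolding z_def using ZD[OF D] Z_ne[OF D] by (intro psubset_card_mono) auto
    then show "d D \<ge> 2" using card_D[OF D] by (cases "d D" rule: nat.exhaust; cases "d D - 1") auto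
  next
    fix D E assume DE: "D \<in> ?D" "E \<in> ?D" "D \<noteq> E"
    have "card D * card E dvd card (UNIV :: 'a set) * z"
      using card_times_card_inter_dvd[OF subgroup[OF DE(1)] subgroup[OF DE(2)]] inter[OF DE]
      by (simp add: z_def)
    then have "(z * z) * (d D * d E) dvd (z * z) * additive_index ?Z"
      using card_D DE card_R by (simp add: mult_ac)
    then show "d D * d E dvd additive_index ?Z" using z0 by simp
  qed
qed

theorem theorem4p3:
  assumes "card (Cent :: ('a::{ring,finite}) set set) = 7"
  shows "additive_index (ring_center :: 'a set) \<in> {12, 18, 20, 24, 25}"
  using index_center_eq_25[OF assms] by simp

end
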